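(* Let $\mathsf{C}$ be a conceptual structures category and let $\mathsf{Adj}(\mathsf{C})_{=}$ be the category of posetal $\mathsf{C}$-objects and $\mathsf{C}$-adjunctions between them. Then the arrow category $\mathsf{Adj}(\mathsf{C})_{=}^{\mathsf{2}}$ is equivalent to the reflection–coreflection factorization category $\mathsf{Ref}(\mathsf{C}) \odot \mathsf{Ref}(\mathsf{C})^\propto$.
   Context: Composition is diagrammatic: $f \cdot g$ means first $f$, then $g$. A conceptual structures (CS) category is an order-enriched category (hom-sets are preorders, composition monotone) with finite limits. An object $A$ is posetal if each hom-preorder $\mathsf{C}(X,A)$ is a partial order. A $\mathsf{C}$-adjunction $g = \langle \check g, \hat g\rangle : A \rightleftharpoons B$ has $\check g : A \rightarrow B$, $\hat g : B \rightarrow A$ with $1_A \leq \check g\cdot\hat g$ and $\hat g \cdot\check g \leq 1_B$; adjunctions compose componentwise, $g \circ h = \langle \check g\cdot\check h, \hat h\cdot\hat g\rangle$. A reflection is an adjunction with $\hat g\cdot\check g = 1_B$; a coreflection one with $\check g \cdot \hat g = 1_A$. $\mathsf{Ref}(\mathsf{C})$ and $\mathsf{Ref}(\mathsf{C})^\propto$ denote the classes of reflections and coreflections between posetal objects. The arrow category $\mathsf{Adj}(\mathsf{C})_{=}^{\mathsf{2}}$ has objects $(A,g,B)$ with $g : A \rightleftharpoons B$ in $\mathsf{Adj}(\mathsf{C})_{=}$, and morphisms $(a,b) : (A_1,g_1,B_1) \rightarrow (A_2,g_2,B_2)$ pairs of adjunctions $a : A_1 \rightleftharpoons A_2$, $b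 : B_1 \rightleftharpoons B_2$ with $a \circ g_2 = g_1 \circ b$. The category $\mathsf{Ref}(\mathsf{C}) \odot \mathsf{Ref}(\mathsf{C})^\propto$ has objects $(A,e,C,m,B)$ with $e : A \rightleftharpoons C$ a reflection and $m : C \rightleftharpoons B$ a coreflection (objects posetal), and morphisms $(a,c,b) : (A_1,e_1,C_1,m_1,B_1) \rightarrow (A_2,e_2,C_2,m_2,B_2)$ triples of adjunctions with $a\circ e_2 = e_1 \circ c$ and $c \circ m_2 = m_1\circ b$. *)

theory Defs
  imports Main
begin

section \<open>Categories, functors, equivalence\<close>

text \<open>Composition is diagrammatic: \<open>f \<cdot> g\<close> is first \<open>f\<close>, then \<open>g\<close>. The values of
  \<open>Dom\<close>, \<open>Cod\<close>, \<open>Id\<close> and \<open>Comp\<close> outside the carriers (or on non-composable pairs)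
  are irrelevant.\<close>

record ('o, 'm) cat =
  Obj :: "'o set"
  Arr :: "'m set"
  Dom :: "'m \<Rightarrow> 'o"
  Cod :: "'m \<Rightarrow> 'o"
  Id :: "'o \<Rightarrow> 'm"
  Comp :: "'m \<Rightarrow> 'm \<Rightarrow> 'm" (infixl "\<cdot>\<index>" 70)

definition Hom :: "('o, 'm, 'x) cat_scheme \<Rightarrow> 'o \<Rightarrow> 'o \<Rightarrow> 'm set" where
  "Hom C A B = {f \<in> Arr C. Dom C f = A \<and> Cod C f = B}"

locale category =
  fixes C :: "('o, 'm, 'x) cat_scheme" (structure)
  assumes Dom_Obj: "f \<in> Arr C \<Longrightarrow> Dom C f \<in> Obj C"
    and Cod_Obj: "f \<in> Arr C \<Longrightarrow> Cod C f \<in> Obj C"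
    and Id_Hom: "A \<in> Obj C \<Longrightarrow> Id C A \<in> Hom C A A"
    and Comp_Hom: "f \<in> Hom C A B \<Longrightarrow> g \<in> Hom C B D \<Longrightarrow> f \<cdot> g \<in> Hom C A D"
    and Id_left: "f \<in> Hom C A B \<Longrightarrow> Id C A \<cdot> f = f"
    and Id_right: "f \<in> Hom C A B \<Longrightarrow> f \<cdot> Id C B = f"
    and Comp_assoc: "f \<in> Hom C A B \<Longrightarrow> g \<in> Hom C B D \<Longrightarrow> h \<in> Hom C D E
      \<Longrightarrow> (f \<cdot> g) \<cdot> h = f \<cdot> (g \<cdot> h)"

record ('o1, 'm1, 'o2, 'm2) func =
  FObj :: "'o1 \<Rightarrow> 'o2"
  FArr :: "'m1 \<Rightarrow> 'm2"

locale is_functor = C: category C + D: category D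
  for C :: "('o1, 'm1, 'x1) cat_scheme" and D :: "('o2, 'm2, 'x2) cat_scheme" +
  fixes F :: "('o1, 'm1, 'o2, 'm2) func"
  assumes FObj_Obj: "A \<in> Obj C \<Longrightarrow> FObj F A \<in> Obj D"
    and FArr_Hom: "f \<in> Hom C A B \<Longrightarrow> FArr F f \<in> Hom D (FObj F A) (FObj F B)"
    and FArr_Id: "A \<in> Obj C \<Longrightarrow> FArr F (Id C A) = Id D (FObj F A)"
    and FArr_Comp: "f \<in> Hom C A B \<Longrightarrow> g \<in> Hom C B E
      \<Longrightarrow> FArr F (f \<cdot>\<^bsub>C\<^esub> g) = FArr F f \<cdot>\<^bsub>D\<^esub> FArr F g"

definition id_func :: "('o, 'm, 'o, 'm) func" where
  "id_func = \<lparr>FObj = (\<lambda>A. A), FArr = (\<lambda>f. f)\<rparr>"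

definition comp_func ::
  "('o1, 'm1, 'o2, 'm2) func \<Rightarrow> ('o2, 'm2, 'o3, 'm3) func \<Rightarrow> ('o1, 'm1, 'o3, 'm3) func"
  where "comp_func F G = \<lparr>FObj = (\<lambda>A. FObj G (FObj F A)), FArr = (\<lambda>f. FArr G (FArr F f))\<rparr>"

definition iso_arr :: "('o, 'm, 'x) cat_scheme \<Rightarrow> 'o \<Rightarrow> 'o \<Rightarrow> 'm \<Rightarrow> bool" where
  "iso_arr C A B f \<longleftrightarrow> f \<in> Hom C A B \<and>
     (\<exists>g \<in> Hom C B A. f \<cdot>\<^bsub>C\<^esub> g = Id C A \<and> g \<cdot>\<^bsub>C\<^esub> f = Id C B)"

definition nat_iso ::
  "('o1, 'm1, 'x1) cat_scheme \<Rightarrow> ('o2, 'm2, 'x2) cat_scheme \<Rightarrow> ('o1, 'm1, 'o2, 'm2) func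
    \<Rightarrow> ('o1, 'm1, 'o2, 'm2) func \<Rightarrow> ('o1 \<Rightarrow> 'm2) \<Rightarrow> bool" where
  "nat_iso C D F G \<eta> \<longleftrightarrow> is_functor C D F \<and> is_functor C D G \<and>
     (\<forall>A \<in> Obj C. iso_arr D (FObj F A) (FObj G A) (\<eta> A)) \<and>
     (\<forall>f \<in> Arr C. FArr F f \<cdot>\<^bsub>D\<^esub> \<eta> (Cod C f) = \<eta> (Dom C f) \<cdot>\<^bsub>D\<^esub> FArr G f)"

definition equivalent_categories ::
  "('o1, 'm1, 'x1) cat_scheme \<Rightarrow> ('o2, 'm2, 'x2) cat_scheme \<Rightarrow> bool" where
  "equivalent_categories C D \<longleftrightarrow>
     (\<exists>F G \<eta> \<epsilon>. is_functor C D F \<and> is_functor D C G \<and>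
        nat_iso C C id_func (comp_func F G) \<eta> \<and>
        nat_iso D D (comp_func G F) id_func \<epsilon>)"

section \<open>Finite limits\<close>

definition is_cone ::
  "('i, 'a, 'y) cat_scheme \<Rightarrow> ('o, 'm, 'x) cat_scheme \<Rightarrow> ('i, 'a, 'o, 'm) func
    \<Rightarrow> 'o \<Rightarrow> ('i \<Rightarrow> 'm) \<Rightarrow> bool" where
  "is_cone J C F L p \<longleftrightarrow> L \<in> Obj C \<and>
     (\<forall>i \<in> Obj J. p i \<in> Hom C L (FObj F i)) \<and>
     (\<forall>u \<in> Arr J. p (Dom J u) \<cdot>\<^bsub>C\<^esub> FArr F u = p (Cod J u))"

definition is_limit ::
  "('i, 'a, 'y) cat_scheme \<Rightarrow> ('o, 'm, 'x) cat_scheme \<Rightarrow> ('i, 'a, 'o, 'm) func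
    \<Rightarrow> 'o \<Rightarrow> ('i \<Rightarrow> 'm) \<Rightarrow> bool" where
  "is_limit J C F L p \<longleftrightarrow> is_cone J C F L p \<and>
     (\<forall>X q. is_cone J C F X q \<longrightarrow>
        (\<exists>!h. h \<in> Hom C X L \<and> (\<forall>i \<in> Obj J. h \<cdot>\<^bsub>C\<^esub> p i = q i)))"

text \<open>A definition cannot quantify over the types carrying the shape of a diagram.
  Shapes with objects and arrows in \<open>nat\<close> suffice, since every finite category is
  isomorphic to one of these.\<close>

definition has_finite_limits :: "('o, 'm, 'x) cat_scheme \<Rightarrow> bool" where
  "has_finite_limits C \<longleftrightarrow>
     (\<forall>(J :: (nat, nat) cat) F. finite (Obj J) \<longrightarrow> finite (Arr J) \<longrightarrow> is_functor J C F
        \<longrightarrow> (\<exists>L p. is_limit J C F L p))"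

section \<open>Conceptual structures categories\<close>

text \<open>Only the restriction of \<open>Le\<close> to parallel arrows is meaningful.\<close>

record ('o, 'm) ord_cat = "('o, 'm) cat" +
  Le :: "'m \<Rightarrow> 'm \<Rightarrow> bool" (infix "\<preceq>\<index>" 50)

locale order_enriched_category = category C
  for C :: "('o, 'm, 'x) ord_cat_scheme" (structure) +
  assumes Le_refl: "reflp_on (Hom C A B) (Le C)"
    and Le_trans: "transp_on (Hom C A B) (Le C)"
    and Comp_mono: "\<lbrakk>f \<in> Hom C A B; f' \<in> Hom C A B; g \<in> Hom C B D; g' \<in> Hom C B D;
      f \<preceq> f'; g \<preceq> g'\<rbrakk> \<Longrightarrow> f \<cdot> g \<preceq> f' \<cdot> g'"

locale cs_category = order_enriched_category +
  assumes finite_limits: "has_finite_limits C"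

definition posetal :: "('o, 'm, 'x) ord_cat_scheme \<Rightarrow> 'o \<Rightarrow> bool" where
  "posetal C A \<longleftrightarrow> A \<in> Obj C \<and> (\<forall>X \<in> Obj C. antisymp_on (Hom C X A) (Le C))"

section \<open>Adjunctions, reflections and coreflections\<close>

text \<open>An adjunction is the pair of its left adjoint \<open>fst g\<close> and its right adjoint
  \<open>snd g\<close>; its source and target are those of the left adjoint.\<close>

definition is_adjunction ::
  "('o, 'm, 'x) ord_cat_scheme \<Rightarrow> 'o \<Rightarrow> 'o \<Rightarrow> 'm \<times> 'm \<Rightarrow> bool" where
  "is_adjunction C A B g \<longleftrightarrow> fst g \<in> Hom C A B \<and> snd g \<in> Hom C B A \<and>
     Id C A \<preceq>\<^bsub>C\<^esub> fst g \<cdot>\<^bsub>C\<^esub> snd g \<and> snd g \<cdot>\<^bsub>C\<^esub> fst g \<preceq>\<^bsub>C\<^esub> Id C B"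

definition Adj_eq :: "('o, 'm, 'x) ord_cat_scheme \<Rightarrow> ('o, 'm \<times> 'm) cat" where
  "Adj_eq C = \<lparr>
     Obj = {A. posetal C A},
     Arr = {g. \<exists>A B. posetal C A \<and> posetal C B \<and> is_adjunction C A B g},
     Dom = (\<lambda>g. Dom C (fst g)),
     Cod = (\<lambda>g. Cod C (fst g)),
     Id = (\<lambda>A. (Id C A, Id C A)),
     Comp = (\<lambda>g h. (fst g \<cdot>\<^bsub>C\<^esub> fst h, snd h \<cdot>\<^bsub>C\<^esub> snd g))\<rparr>"

definition Ref :: "('o, 'm, 'x) ord_cat_scheme \<Rightarrow> ('m \<times> 'm) set" where
  "Ref C = {g. \<exists>A B. posetal C A \<and> posetal C B \<and> is_adjunction C A B g \<and>
     snd g \<cdot>\<^bsub>C\<^esub> fst g = Id C B}"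

definition Coref :: "('o, 'm, 'x) ord_cat_scheme \<Rightarrow> ('m \<times> 'm) set" where
  "Coref C = {g. \<exists>A B. posetal C A \<and> posetal C B \<and> is_adjunction C A B g \<and>
     fst g \<cdot>\<^bsub>C\<^esub> snd g = Id C A}"

section \<open>Arrow categories and factorization categories\<close>

text \<open>Arrows carry their source and target objects, because a pair \<open>(a, b)\<close> or a triple
  \<open>(a, c, b)\<close> alone does not determine them.\<close>

type_synonym ('o, 'm) arrow_obj = "'o \<times> 'm \<times> 'o"

definition arrow_cat :: "('o, 'm, 'x) cat_scheme
    \<Rightarrow> (('o, 'm) arrow_obj, ('o, 'm) arrow_obj \<times> ('m \<times> 'm) \<times> ('o, 'm) arrow_obj) cat" where
  "arrow_cat K = \<lparr>
     Obj = {(A, g, B). A \<in> Obj K \<and> B \<in> Obj K \<and> g \<in> Hom K A B},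
     Arr = {((A1, g1, B1), (a, b), (A2, g2, B2)).
       g1 \<in> Hom K A1 B1 \<and> g2 \<in> Hom K A2 B2 \<and> a \<in> Hom K A1 A2 \<and> b \<in> Hom K B1 B2 \<and>
       a \<cdot>\<^bsub>K\<^esub> g2 = g1 \<cdot>\<^bsub>K\<^esub> b},
     Dom = (\<lambda>(X, f, Y). X),
     Cod = (\<lambda>(X, f, Y). Y),
     Id = (\<lambda>(A, g, B). ((A, g, B), (Id K A, Id K B), (A, g, B))),
     Comp = (\<lambda>(X, (a, b), Y) (Y', (a', b'), Z). (X, (a \<cdot>\<^bsub>K\<^esub> a', b \<cdot>\<^bsub>K\<^esub> b'), Z))\<rparr>"

type_synonym ('o, 'm) fact_obj = "'o \<times> 'm \<times> 'o \<times> 'm \<times> 'o"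

definition fact_cat :: "('o, 'm, 'x) cat_scheme \<Rightarrow> 'm set \<Rightarrow> 'm set
    \<Rightarrow> (('o, 'm) fact_obj, ('o, 'm) fact_obj \<times> ('m \<times> 'm \<times> 'm) \<times> ('o, 'm) fact_obj) cat" where
  "fact_cat K E M = \<lparr>
     Obj = {(A, e, C, m, B). A \<in> Obj K \<and> C \<in> Obj K \<and> B \<in> Obj K \<and>
       e \<in> E \<inter> Hom K A C \<and> m \<in> M \<inter> Hom K C B},
     Arr = {((A1, e1, C1, m1, B1), (a, c, b), (A2, e2, C2, m2, B2)).
       e1 \<in> E \<inter> Hom K A1 C1 \<and> m1 \<in> M \<inter> Hom K C1 B1 \<and>
       e2 \<in> E \<inter> Hom K A2 C2 \<and> m2 \<in> M \<inter> Hom K C2 B2 \<and>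
       a \<in> Hom K A1 A2 \<and> c \<in> Hom K C1 C2 \<and> b \<in> Hom K B1 B2 \<and>
       a \<cdot>\<^bsub>K\<^esub> e2 = e1 \<cdot>\<^bsub>K\<^esub> c \<and> c \<cdot>\<^bsub>K\<^esub> m2 = m1 \<cdot>\<^bsub>K\<^esub> b},
     Dom = (\<lambda>(X, f, Y). X),
     Cod = (\<lambda>(X, f, Y). Y),
     Id = (\<lambda>(A, e, C, m, B).
       ((A, e, C, m, B), (Id K A, Id K C, Id K B), (A, e, C, m, B))),
     Comp = (\<lambda>(X, (a, c, b), Y) (Y', (a', c', b'), Z).
       (X, (a \<cdot>\<^bsub>K\<^esub> a', c \<cdot>\<^bsub>K\<^esub> c', b \<cdot>\<^bsub>K\<^esub> b'), Z))\<rparr>"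

end

theory Submission
  imports Defs
begin

text \<open>For an adjunction \<open>g = (l, r)\<close> between posetal objects, \<open>l \<cdot> r\<close> is idempotent by the
  triangle identities. Finite limits split it, and the splitting factors \<open>g\<close> as a reflection
  followed by a coreflection. Commuting squares between such factorizations have unique
  diagonals, so composing the two factors is a fully faithful functor from the factorization
  category to the arrow category, and it is surjective on objects.\<close>

section \<open>Equivalences from fully faithful functors\<close>

text \<open>For a Galois connection between posets, \<open>l \<cdot> r\<close> is a closure operator
  and the middle object is its poset of closed elements, so \<open>D\<close> is the categorical form
  of that poset. Antisymmetry is what makes the idempotence strict: over mere preorders the triangle
  identities hold only up to mutual comparability, and a limit could not be applied to them.
  \<open>has_finite_limits\<close> speaks of the underlying category alone, so the limit says
  nothing about the order on arrows into \<open>D\<close>; that \<open>D\<close> is posetal comes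
  from its being a retract of the source of \<open>g\<close>. A splitting is unique only up to
  isomorphism, so factoring depends on a choice.\<close>

lemma HomD:
  assumes "f \<in> Hom C A B"
  shows "f \<in> Arr C" "Dom C f = A" "Cod C f = B"
  using assms by (simp_all add: Hom_def)

lemma Arr_Hom: "f \<in> Arr C \<Longrightarrow> f \<in> Hom C (Dom C f) (Cod C f)"
  by (simp add: Hom_def)

context category
begin

lemma Hom_Obj: "f \<in> Hom C A B \<Longrightarrow> A \<in> Obj C" "f \<in> Hom C A B \<Longrightarrow> B \<in> Obj C"
  using Dom_Obj Cod_Obj by (auto simp: Hom_def)

text \<open>In the \<open>Hom\<close> form of the axioms, the intermediate objects do not occur in
  the equation to be rewritten. Stated through \<open>Dom\<close> and \<open>Cod\<close>, this and
  the next four facts become conditional rewrite rules that normalize composites to right-nested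
  form.\<close>

lemma Comp_arr:
  assumes "f \<in> Arr C" "g \<in> Arr C" "Cod C f = Dom C g"
  shows "f \<cdot> g \<in> Arr C" "Dom C (f \<cdot> g) = Dom C f" "Cod C (f \<cdot> g) = Cod C g"
  using Comp_Hom[of f "Dom C f" "Cod C f" g "Cod C g"] assms by (auto simp: Hom_def)

lemma Comp_assoc_arr:
  assumes "f \<in> Arr C" "g \<in> Arr C" "h \<in> Arr C" "Cod C f = Dom C g" "Cod C g = Dom C h"
  shows "(f \<cdot> g) \<cdot> h = f \<cdot> (g \<cdot> h)"
  using Comp_assoc[of f "Dom C f" "Cod C f" g "Cod C g" h "Cod C h"] assms by (auto simp: Hom_def)

lemma Id_arr:
  assumes "A \<in> Obj C"
  shows "Id C A \<in> Arr C" "Dom C (Id C A) = A" "Cod C (Id C A) = A"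
  using Id_Hom[OF assms] by (auto simp: Hom_def)

lemma Id_left_arr: "f \<in> Arr C \<Longrightarrow> Dom C f = A \<Longrightarrow> Id C A \<cdot> f = f"
  using Id_left[of f "Dom C f" "Cod C f"] by (auto simp: Hom_def)

lemma Id_right_arr: "f \<in> Arr C \<Longrightarrow> Cod C f = B \<Longrightarrow> f \<cdot> Id C B = f"
  using Id_right[of f "Dom C f" "Cod C f"] by (auto simp: Hom_def)

lemmas arr_simps = Comp_arr Comp_assoc_arr Id_arr Id_left_arr Id_right_arr

lemma is_functor_id: "is_functor C C id_func"
  by unfold_locales (auto simp: id_func_def)

lemma iso_arr_Id: "A \<in> Obj C \<Longrightarrow> iso_arr C A A (Id C A)"
  unfolding iso_arr_def using Id_Hom[of A] Id_left[of "Id C A" A A] by blast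

end

lemma is_functor_comp:
  assumes "is_functor C D F" "is_functor D E G"
  shows "is_functor C E (comp_func F G)"
proof -
  interpret F: is_functor C D F by fact
  interpret G: is_functor D E G by fact
  show ?thesis
    by unfold_locales
      (auto simp: comp_func_def F.FObj_Obj F.FArr_Id F.FArr_Comp
        intro: G.FObj_Obj G.FArr_Id G.FArr_Comp F.FArr_Hom G.FArr_Hom)
qed

text \<open>The quasi-inverse is \<open>s\<close> on objects and the unique lift along
  \<open>G\<close> on arrows. Because \<open>s\<close> is a strict section, the round trip on
  \<open>C\<close> is the identity and its natural isomorphism is \<open>Id C\<close>. Every
  equation in \<open>D\<close> is checked after applying \<open>G\<close> and then transported back
  by faithfulness.\<close>

lemma equivalent_if_fully_faithful_section:
  assumes G: "is_functor D C G"
    and sec: "\<And>X. X \<in> Obj C \<Longrightarrow> s X \<in> Obj D" "\<And>X. X \<in> Obj C \<Longrightarrow> FObj G (s X) = X"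
    and bij: "\<And>Y Z. Y \<in> Obj D \<Longrightarrow> Z \<in> Obj D
      \<Longrightarrow> bij_betw (FArr G) (Hom D Y Z) (Hom C (FObj G Y) (FObj G Z))"
  shows "equivalent_categories C D"
proof -
  interpret G: is_functor D C G by (rule G)
  define lift where "lift Y Z f = inv_into (Hom D Y Z) (FArr G) f" for Y Z f
  have lift: "lift Y Z f \<in> Hom D Y Z" "FArr G (lift Y Z f) = f"
    if "Y \<in> Obj D" "Z \<in> Obj D" "f \<in> Hom C (FObj G Y) (FObj G Z)" for Y Z f
    using bij[OF that(1,2)] that(3) unfolding lift_def
    by (auto simp: bij_betw_def inv_into_into f_inv_into_f)
  have faithful: "f = g"
    if "f \<in> Hom D Y Z" "g \<in> Hom D Y Z" "FArr G f = FArr G g" for Y Z f g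
    using bij[of Y Z] G.C.Hom_Obj[OF that(1)] that
    by (auto simp: bij_betw_def inj_on_def)
  define F where
    "F = \<lparr>FObj = s, FArr = (\<lambda>f. lift (s (Dom C f)) (s (Cod C f)) f)\<rparr>"
  \<comment> \<open>\<open>s (FObj G Y)\<close> and \<open>Y\<close> have the same image under
    \<open>G\<close>, so the identity of that image is an arrow between the images and can be
    lifted.\<close>
  define \<epsilon> where "\<epsilon> Y = lift (s (FObj G Y)) Y (Id C (FObj G Y))" for Y
  have F_Obj: "FObj F X \<in> Obj D" "FObj G (FObj F X) = X" if "X \<in> Obj C" for X
    using sec that by (simp_all add: F_def)
  have F_Hom: "FArr F f \<in> Hom D (FObj F X) (FObj F Y)" and GF: "FArr G (FArr F f) = f"
    if "f \<in> Hom C X Y" for f X Y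
    using lift[of "s X" "s Y" f] sec G.D.Hom_Obj[OF that] that
    by (auto simp: F_def HomD[OF that])
  interpret F: is_functor C D F
  proof
    fix X assume "X \<in> Obj C"
    then show "FObj F X \<in> Obj D" by (rule F_Obj)
  next
    fix f X Y assume "f \<in> Hom C X Y"
    then show "FArr F f \<in> Hom D (FObj F X) (FObj F Y)" by (rule F_Hom)
  next
    fix X assume X: "X \<in> Obj C"
    show "FArr F (Id C X) = Id D (FObj F X)"
      by (rule faithful[OF F_Hom[OF G.D.Id_Hom[OF X]] G.C.Id_Hom])
        (simp_all add: GF[OF G.D.Id_Hom[OF X]] G.FArr_Id F_Obj X)
  next
    fix f g X Y Z assume fg: "f \<in> Hom C X Y" "g \<in> Hom C Y Z"
    show "FArr F (f \<cdot>\<^bsub>C\<^esub> g) = FArr F f \<cdot>\<^bsub>D\<^esub> FArr F g"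
      by (rule faithful[OF F_Hom[OF G.D.Comp_Hom[OF fg]]
            G.C.Comp_Hom[OF F_Hom[OF fg(1)] F_Hom[OF fg(2)]]])
        (simp add: GF[OF G.D.Comp_Hom[OF fg]] G.FArr_Comp[OF F_Hom[OF fg(1)] F_Hom[OF fg(2)]]
          GF[OF fg(1)] GF[OF fg(2)])
  qed
  have FG: "is_functor C C (comp_func F G)" and GF_functor: "is_functor D D (comp_func G F)"
    by (rule is_functor_comp[OF F.is_functor_axioms G]
        is_functor_comp[OF G F.is_functor_axioms])+
  have \<epsilon>: "\<epsilon> Y \<in> Hom D (FObj F (FObj G Y)) Y" "FArr G (\<epsilon> Y) = Id C (FObj G Y)"
    if Y: "Y \<in> Obj D" for Y
    using lift[of "s (FObj G Y)" Y "Id C (FObj G Y)"] sec G.FObj_Obj[OF Y] Y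
      G.D.Id_Hom[OF G.FObj_Obj[OF Y]]
    by (auto simp: \<epsilon>_def F_def)
  have "nat_iso C C id_func (comp_func F G) (Id C)"
    unfolding nat_iso_def
  proof (intro conjI ballI)
    show "is_functor C C id_func" by (rule G.D.is_functor_id)
    show "is_functor C C (comp_func F G)" by (rule FG)
    fix X assume "X \<in> Obj C"
    then show "iso_arr C (FObj id_func X) (FObj (comp_func F G) X) (Id C X)"
      using G.D.iso_arr_Id by (simp add: id_func_def comp_func_def F_Obj)
  next
    fix f assume "f \<in> Arr C"
    then show "FArr id_func f \<cdot>\<^bsub>C\<^esub> Id C (Cod C f) = Id C (Dom C f) \<cdot>\<^bsub>C\<^esub> FArr (comp_func F G) f"
      by (simp add: id_func_def comp_func_def GF[OF Arr_Hom] G.D.Id_left_arr G.D.Id_right_arr)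
  qed
  moreover have "nat_iso D D (comp_func G F) id_func \<epsilon>"
    unfolding nat_iso_def
  proof (intro conjI ballI)
    show "is_functor D D (comp_func G F)" by (rule GF_functor)
    show "is_functor D D id_func" by (rule G.C.is_functor_id)
    fix Y assume Y: "Y \<in> Obj D"
    let ?X = "FObj G Y"
    let ?Y = "FObj F ?X"
    \<comment> \<open>The inverse of \<open>\<epsilon> Y\<close> lifts the same identity in the
      other direction; both composites then lie over an identity.\<close>
    define \<delta> where "\<delta> = lift Y ?Y (Id C ?X)"
    have X: "?X \<in> Obj C" using G.FObj_Obj[OF Y] .
    have Y': "?Y \<in> Obj D" "FObj G ?Y = ?X" using F_Obj[OF X] by auto
    have \<delta>: "\<delta> \<in> Hom D Y ?Y" "FArr G \<delta> = Id C ?X"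
      using lift[OF Y Y'(1)] Y'(2) G.D.Id_Hom[OF X] by (auto simp: \<delta>_def)
    note [simp] = G.D.Id_left[OF G.D.Id_Hom[OF X]]
    have "\<epsilon> Y \<cdot>\<^bsub>D\<^esub> \<delta> = Id D ?Y"
      by (rule faithful[OF G.C.Comp_Hom[OF \<epsilon>(1)[OF Y] \<delta>(1)] G.C.Id_Hom[OF Y'(1)]])
        (simp add: G.FArr_Comp[OF \<epsilon>(1)[OF Y] \<delta>(1)] \<epsilon>(2)[OF Y] \<delta>(2) G.FArr_Id Y')
    moreover have "\<delta> \<cdot>\<^bsub>D\<^esub> \<epsilon> Y = Id D Y"
      by (rule faithful[OF G.C.Comp_Hom[OF \<delta>(1) \<epsilon>(1)[OF Y]] G.C.Id_Hom[OF Y]])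
        (simp add: G.FArr_Comp[OF \<delta>(1) \<epsilon>(1)[OF Y]] \<epsilon>(2)[OF Y] \<delta>(2) G.FArr_Id Y)
    ultimately show "iso_arr D (FObj (comp_func G F) Y) (FObj id_func Y) (\<epsilon> Y)"
      unfolding iso_arr_def using \<epsilon>(1)[OF Y] \<delta>(1) by (auto simp: comp_func_def id_func_def)
  next
    fix f assume "f \<in> Arr D"
    then have f: "f \<in> Hom D (Dom D f) (Cod D f)" by (rule Arr_Hom)
    note Gf = G.FArr_Hom[OF f] and dom = G.C.Hom_Obj(1)[OF f] and cod = G.C.Hom_Obj(2)[OF f]
    have "FArr F (FArr G f) \<cdot>\<^bsub>D\<^esub> \<epsilon> (Cod D f) = \<epsilon> (Dom D f) \<cdot>\<^bsub>D\<^esub> f"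
      by (rule faithful[OF G.C.Comp_Hom[OF F_Hom[OF Gf] \<epsilon>(1)[OF cod]]
            G.C.Comp_Hom[OF \<epsilon>(1)[OF dom] f]])
        (simp add: G.FArr_Comp[OF F_Hom[OF Gf] \<epsilon>(1)[OF cod]] G.FArr_Comp[OF \<epsilon>(1)[OF dom] f]
          GF[OF Gf] \<epsilon>(2) dom cod G.D.Id_left[OF Gf] G.D.Id_right[OF Gf])
    then show "FArr (comp_func G F) f \<cdot>\<^bsub>D\<^esub> \<epsilon> (Cod D f) = \<epsilon> (Dom D f) \<cdot>\<^bsub>D\<^esub> FArr id_func f"
      by (simp add: comp_func_def id_func_def)
  qed
  ultimately show ?thesis
    unfolding equivalent_categories_def
    using F.is_functor_axioms G by blast
qed

section \<open>The composition functor of a factorization category\<close>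

context category
begin

text \<open>Used in both directions: as stated it composes arrows of the two categories; read from
  right to left, with the roles of sides and rungs exchanged, it shows that the two squares of a
  factorization arrow paste to one square between the composites \<open>e \<cdot> m\<close>.\<close>

lemma paste_squares:
  assumes "f1 \<in> Hom C A1 B1" "f2 \<in> Hom C A2 B2" "f3 \<in> Hom C A3 B3"
    and "a \<in> Hom C A1 A2" "a' \<in> Hom C A2 A3" "b \<in> Hom C B1 B2" "b' \<in> Hom C B2 B3"
    and eq: "a \<cdot> f2 = f1 \<cdot> b" "a' \<cdot> f3 = f2 \<cdot> b'"
  shows "(a \<cdot> a') \<cdot> f3 = f1 \<cdot> (b \<cdot> b')"
proof -
  have "(a \<cdot> a') \<cdot> f3 = a \<cdot> (f2 \<cdot> b')"
    using assms(1-7) by (simp add: HomD arr_simps flip: eq(2))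
  also have "\<dots> = (a \<cdot> f2) \<cdot> b'"
    using assms(1-7) by (simp add: HomD arr_simps)
  also have "\<dots> = f1 \<cdot> (b \<cdot> b')"
    using assms(1-7) by (simp add: eq(1) HomD arr_simps)
  finally show ?thesis .
qed

section \<open>The arrow category and the factorization category over an arbitrary category\<close>

lemma arrow_cat_Hom_iff:
  "F \<in> Hom (arrow_cat C) (A1, g1, B1) (A2, g2, B2) \<longleftrightarrow>
    (\<exists>a b. F = ((A1, g1, B1), (a, b), (A2, g2, B2)) \<and>
      g1 \<in> Hom C A1 B1 \<and> g2 \<in> Hom C A2 B2 \<and> a \<in> Hom C A1 A2 \<and> b \<in> Hom C B1 B2 \<and>
      a \<cdot> g2 = g1 \<cdot> b)"
  by (cases F) (auto simp: arrow_cat_def Hom_def)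

lemma fact_cat_Hom_iff:
  "F \<in> Hom (fact_cat C E M) (A1, e1, D1, m1, B1) (A2, e2, D2, m2, B2) \<longleftrightarrow>
    (\<exists>a c b. F = ((A1, e1, D1, m1, B1), (a, c, b), (A2, e2, D2, m2, B2)) \<and>
      e1 \<in> E \<inter> Hom C A1 D1 \<and> m1 \<in> M \<inter> Hom C D1 B1 \<and>
      e2 \<in> E \<inter> Hom C A2 D2 \<and> m2 \<in> M \<inter> Hom C D2 B2 \<and>
      a \<in> Hom C A1 A2 \<and> c \<in> Hom C D1 D2 \<and> b \<in> Hom C B1 B2 \<and>
      a \<cdot> e2 = e1 \<cdot> c \<and> c \<cdot> m2 = m1 \<cdot> b)"
  by (cases F) (auto simp: fact_cat_def Hom_def)

lemma category_arrow_cat: "category (arrow_cat C)"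
proof
  fix F assume "F \<in> Arr (arrow_cat C)"
  then show "Dom (arrow_cat C) F \<in> Obj (arrow_cat C)" "Cod (arrow_cat C) F \<in> Obj (arrow_cat C)"
    by (auto simp: arrow_cat_def Hom_Obj)
next
  fix X assume "X \<in> Obj (arrow_cat C)"
  then show "Id (arrow_cat C) X \<in> Hom (arrow_cat C) X X"
    by (cases X) (auto simp: arrow_cat_Hom_iff, auto simp: arrow_cat_def Id_Hom Id_left Id_right)
next
  fix F G X Y Z assume "F \<in> Hom (arrow_cat C) X Y" "G \<in> Hom (arrow_cat C) Y Z"
  then show "Comp (arrow_cat C) F G \<in> Hom (arrow_cat C) X Z"
    by (cases X; cases Y; cases Z)
      (auto simp: arrow_cat_Hom_iff, auto simp: arrow_cat_def intro: Comp_Hom paste_squares)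
next
  fix F X Y assume "F \<in> Hom (arrow_cat C) X Y"
  then show "Comp (arrow_cat C) (Id (arrow_cat C) X) F = F"
    "Comp (arrow_cat C) F (Id (arrow_cat C) Y) = F"
    by (cases X; cases Y; auto simp: arrow_cat_Hom_iff, auto simp: arrow_cat_def Id_left Id_right)+
next
  fix F G H X Y Z W
  assume "F \<in> Hom (arrow_cat C) X Y" "G \<in> Hom (arrow_cat C) Y Z" "H \<in> Hom (arrow_cat C) Z W"
  then show "Comp (arrow_cat C) (Comp (arrow_cat C) F G) H
      = Comp (arrow_cat C) F (Comp (arrow_cat C) G H)"
    by (cases X; cases Y; cases Z; cases W)
      (auto simp: arrow_cat_Hom_iff, auto simp: arrow_cat_def Comp_assoc)
qed

lemma category_fact_cat: "category (fact_cat C E M)"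
proof
  fix F assume "F \<in> Arr (fact_cat C E M)"
  then show "Dom (fact_cat C E M) F \<in> Obj (fact_cat C E M)"
    "Cod (fact_cat C E M) F \<in> Obj (fact_cat C E M)"
    by (auto simp: fact_cat_def Hom_Obj)
next
  fix X assume "X \<in> Obj (fact_cat C E M)"
  then show "Id (fact_cat C E M) X \<in> Hom (fact_cat C E M) X X"
    by (cases X) (auto simp: fact_cat_Hom_iff, auto simp: fact_cat_def Id_Hom Id_left Id_right)
next
  fix F G X Y Z assume "F \<in> Hom (fact_cat C E M) X Y" "G \<in> Hom (fact_cat C E M) Y Z"
  then show "Comp (fact_cat C E M) F G \<in> Hom (fact_cat C E M) X Z"
    by (cases X; cases Y; cases Z)
      (auto simp: fact_cat_Hom_iff, auto simp: fact_cat_def intro: Comp_Hom paste_squares)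
next
  fix F X Y assume "F \<in> Hom (fact_cat C E M) X Y"
  then show "Comp (fact_cat C E M) (Id (fact_cat C E M) X) F = F"
    "Comp (fact_cat C E M) F (Id (fact_cat C E M) Y) = F"
    by (cases X; cases Y; auto simp: fact_cat_Hom_iff, auto simp: fact_cat_def Id_left Id_right)+
next
  fix F G H X Y Z W
  assume "F \<in> Hom (fact_cat C E M) X Y" "G \<in> Hom (fact_cat C E M) Y Z"
    "H \<in> Hom (fact_cat C E M) Z W"
  then show "Comp (fact_cat C E M) (Comp (fact_cat C E M) F G) H
      = Comp (fact_cat C E M) F (Comp (fact_cat C E M) G H)"
    by (cases X; cases Y; cases Z; cases W)
      (auto simp: fact_cat_Hom_iff, auto simp: fact_cat_def Comp_assoc)
qed

text \<open>On arrows only the middle component \<open>c\<close> is forgotten. Hence fullness is the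
  existence of a diagonal, and faithfulness its uniqueness.\<close>

definition composition_func ::
  "(('o, 'm) fact_obj, ('o, 'm) fact_obj \<times> ('m \<times> 'm \<times> 'm) \<times> ('o, 'm) fact_obj,
    ('o, 'm) arrow_obj, ('o, 'm) arrow_obj \<times> ('m \<times> 'm) \<times> ('o, 'm) arrow_obj) func" where
  "composition_func = (let G = (\<lambda>(A, e, D, m, B). (A, e \<cdot> m, B)) in
    \<lparr>FObj = G, FArr = (\<lambda>(X, (a, c, b), Y). (G X, (a, b), G Y))\<rparr>)"

lemma composition_func_simps:
  "FObj composition_func (A, e, D, m, B) = (A, e \<cdot> m, B)"
  "FArr composition_func (X, (a, c, b), Y)
    = (FObj composition_func X, (a, b), FObj composition_func Y)"
  by (simp_all add: composition_func_def Let_def)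

lemma is_functor_composition: "is_functor (fact_cat C E M) (arrow_cat C) composition_func"
proof -
  interpret A: category "arrow_cat C" by (rule category_arrow_cat)
  interpret F: category "fact_cat C E M" by (rule category_fact_cat)
  show ?thesis
  proof
    fix X assume "X \<in> Obj (fact_cat C E M)"
    then show "FObj composition_func X \<in> Obj (arrow_cat C)"
      by (cases X) (auto simp: composition_func_simps arrow_cat_def fact_cat_def intro: Comp_Hom)
  next
    fix F X Y assume "F \<in> Hom (fact_cat C E M) X Y"
    then show "FArr composition_func F
      \<in> Hom (arrow_cat C) (FObj composition_func X) (FObj composition_func Y)"
      by (cases X; cases Y)
        (auto simp: composition_func_simps arrow_cat_Hom_iff fact_cat_Hom_iff
          intro!: Comp_Hom paste_squares[symmetric])
  next
    fix X assume "X \<in> Obj (fact_cat C E M)"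
    then show "FArr composition_func (Id (fact_cat C E M) X)
      = Id (arrow_cat C) (FObj composition_func X)"
      by (cases X) (auto simp: fact_cat_def arrow_cat_def composition_func_simps)
  next
    fix F G X Y Z assume "F \<in> Hom (fact_cat C E M) X Y" "G \<in> Hom (fact_cat C E M) Y Z"
    then show "FArr composition_func (F \<cdot>\<^bsub>fact_cat C E M\<^esub> G)
      = FArr composition_func F \<cdot>\<^bsub>arrow_cat C\<^esub> FArr composition_func G"
      by (cases X; cases Y; cases Z)
        (auto simp: fact_cat_Hom_iff, auto simp: fact_cat_def arrow_cat_def composition_func_simps)
  qed
qed

text \<open>\<open>factor\<close> supplies the strict section on objects. \<open>diagonal\<close>
  says that \<open>FArr composition_func\<close> is bijective on each hom-set: a square between two
  composites splits through the middle objects in exactly one way.\<close>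

lemma arrow_cat_equivalent_fact_cat:
  assumes factor: "\<And>A B g. g \<in> Hom C A B
      \<Longrightarrow> \<exists>D. \<exists>e \<in> E \<inter> Hom C A D. \<exists>m \<in> M \<inter> Hom C D B. e \<cdot> m = g"
    and diagonal: "\<And>A1 D1 B1 A2 D2 B2 e1 m1 e2 m2 a b.
      \<lbrakk>e1 \<in> E \<inter> Hom C A1 D1; m1 \<in> M \<inter> Hom C D1 B1;
       e2 \<in> E \<inter> Hom C A2 D2; m2 \<in> M \<inter> Hom C D2 B2;
       a \<in> Hom C A1 A2; b \<in> Hom C B1 B2; a \<cdot> (e2 \<cdot> m2) = (e1 \<cdot> m1) \<cdot> b\<rbrakk>
      \<Longrightarrow> \<exists>!c. c \<in> Hom C D1 D2 \<and> a \<cdot> e2 = e1 \<cdot> c \<and> c \<cdot> m2 = m1 \<cdot> b"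
  shows "equivalent_categories (arrow_cat C) (fact_cat C E M)"
proof -
  have "\<exists>Y \<in> Obj (fact_cat C E M). FObj composition_func Y = X"
    if X: "X \<in> Obj (arrow_cat C)" for X
  proof -
    obtain A g B where [simp]: "X = (A, g, B)" by (cases X)
    have "g \<in> Hom C A B" using X by (simp add: arrow_cat_def)
    from factor[OF this] obtain D e m
      where em: "e \<in> E \<inter> Hom C A D" "m \<in> M \<inter> Hom C D B" "e \<cdot> m = g" by blast
    then have "(A, e, D, m, B) \<in> Obj (fact_cat C E M)"
      by (auto simp: fact_cat_def intro: Hom_Obj)
    moreover have "FObj composition_func (A, e, D, m, B) = X"
      by (simp add: composition_func_simps em)
    ultimately show ?thesis by blast
  qed
  then obtain s where s: "\<And>X. X \<in> Obj (arrow_cat C) \<Longrightarrow> s X \<in> Obj (fact_cat C E M)"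
    "\<And>X. X \<in> Obj (arrow_cat C) \<Longrightarrow> FObj composition_func (s X) = X"
    by metis
  show ?thesis
  proof (rule equivalent_if_fully_faithful_section[OF is_functor_composition s])
    fix Y Z assume YZ: "Y \<in> Obj (fact_cat C E M)" "Z \<in> Obj (fact_cat C E M)"
    obtain A1 e1 D1 m1 B1 A2 e2 D2 m2 B2
      where [simp]: "Y = (A1, e1, D1, m1, B1)" "Z = (A2, e2, D2, m2, B2)"
      by (cases Y; cases Z)
    have em: "e1 \<in> E \<inter> Hom C A1 D1" "m1 \<in> M \<inter> Hom C D1 B1"
      "e2 \<in> E \<inter> Hom C A2 D2" "m2 \<in> M \<inter> Hom C D2 B2"
      using YZ by (auto simp: fact_cat_def)
    interpret G: is_functor "fact_cat C E M" "arrow_cat C" composition_func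
      by (rule is_functor_composition)
    show "bij_betw (FArr composition_func) (Hom (fact_cat C E M) Y Z)
      (Hom (arrow_cat C) (FObj composition_func Y) (FObj composition_func Z))"
      unfolding bij_betw_def
    proof
      show "inj_on (FArr composition_func) (Hom (fact_cat C E M) Y Z)"
      proof (rule inj_onI)
        fix F G assume FG: "F \<in> Hom (fact_cat C E M) Y Z" "G \<in> Hom (fact_cat C E M) Y Z"
          "FArr composition_func F = FArr composition_func G"
        from FG obtain a b c c' where F: "F = (Y, (a, c, b), Z)" "G = (Y, (a, c', b), Z)"
          and ab: "a \<in> Hom C A1 A2" "b \<in> Hom C B1 B2"
          and c: "c \<in> Hom C D1 D2 \<and> a \<cdot> e2 = e1 \<cdot> c \<and> c \<cdot> m2 = m1 \<cdot> b"
          and c': "c' \<in> Hom C D1 D2 \<and> a \<cdot> e2 = e1 \<cdot> c' \<and> c' \<cdot> m2 = m1 \<cdot> b"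
          by (auto simp: fact_cat_Hom_iff composition_func_simps)
        \<comment> \<open>\<open>diagonal\<close> asks for the outer square; it is the condition
          carried by the image of \<open>F\<close> in the arrow category.\<close>
        have "a \<cdot> (e2 \<cdot> m2) = (e1 \<cdot> m1) \<cdot> b"
          using G.FArr_Hom[OF FG(1)] F by (simp add: arrow_cat_Hom_iff composition_func_simps)
        from diagonal[OF em ab this] c c' have "c = c'" by blast
        then show "F = G" using F by simp
      qed
      show "FArr composition_func ` Hom (fact_cat C E M) Y Z
        = Hom (arrow_cat C) (FObj composition_func Y) (FObj composition_func Z)"
      proof (intro equalityI subsetI)
        fix F assume "F \<in> Hom (arrow_cat C) (FObj composition_func Y) (FObj composition_func Z)"
        then obtain a b where F: "F = (FObj composition_func Y, (a, b), FObj composition_func Z)"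
          and ab: "a \<in> Hom C A1 A2" "b \<in> Hom C B1 B2" "a \<cdot> (e2 \<cdot> m2) = (e1 \<cdot> m1) \<cdot> b"
          by (auto simp: arrow_cat_Hom_iff composition_func_simps)
        from diagonal[OF em ab] obtain c
          where "c \<in> Hom C D1 D2" "a \<cdot> e2 = e1 \<cdot> c" "c \<cdot> m2 = m1 \<cdot> b" by blast
        with em ab have "(Y, (a, c, b), Z) \<in> Hom (fact_cat C E M) Y Z"
          by (auto simp: fact_cat_Hom_iff)
        then show "F \<in> FArr composition_func ` Hom (fact_cat C E M) Y Z"
          by (rule image_eqI[rotated]) (simp only: F composition_func_simps)
      qed (auto intro: G.FArr_Hom)
    qed
  qed
qed

end

section \<open>Adjunctions between posetal objects\<close>

lemma posetal_antisym:
  assumes "posetal C A" "X \<in> Obj C" "f \<in> Hom C X A" "g \<in> Hom C X A" "f \<preceq>\<^bsub>C\<^esub> g" "g \<preceq>\<^bsub>C\<^esub> f"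
  shows "f = g"
  using assms unfolding posetal_def by (blast dest: antisymp_onD)

lemma Adj_eq_Hom_iff:
  "g \<in> Hom (Adj_eq C) A B \<longleftrightarrow> posetal C A \<and> posetal C B \<and> is_adjunction C A B g"
  by (auto simp: Adj_eq_def Hom_def is_adjunction_def)

lemma Adj_eq_simps:
  "Obj (Adj_eq C) = {A. posetal C A}"
  "Id (Adj_eq C) A = (Id C A, Id C A)"
  "g \<cdot>\<^bsub>Adj_eq C\<^esub> h = (fst g \<cdot>\<^bsub>C\<^esub> fst h, snd h \<cdot>\<^bsub>C\<^esub> snd g)"
  by (simp_all add: Adj_eq_def)

text \<open>\<open>Ref C\<close> quantifies its endpoints existentially, but \<open>Dom\<close> and
  \<open>Cod\<close> of the left adjoint determine them, so they agree with the prescribed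
  \<open>A\<close> and \<open>B\<close>.\<close>

lemma Ref_Hom_iff:
  "e \<in> Ref C \<inter> Hom (Adj_eq C) A B \<longleftrightarrow>
    posetal C A \<and> posetal C B \<and> is_adjunction C A B e \<and> snd e \<cdot>\<^bsub>C\<^esub> fst e = Id C B"
  by (auto simp: Ref_def Adj_eq_Hom_iff) (auto simp: is_adjunction_def Hom_def)

lemma Coref_Hom_iff:
  "m \<in> Coref C \<inter> Hom (Adj_eq C) A B \<longleftrightarrow>
    posetal C A \<and> posetal C B \<and> is_adjunction C A B m \<and> fst m \<cdot>\<^bsub>C\<^esub> snd m = Id C A"
  by (auto simp: Coref_def Adj_eq_Hom_iff) (auto simp: is_adjunction_def Hom_def)

section \<open>The category of adjunctions, and diagonals between factorizations\<close>

context order_enriched_category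
begin

lemma Le_reflD: "f \<in> Hom C A B \<Longrightarrow> f \<preceq> f"
  using Le_refl by (auto dest: reflp_onD)

lemma Le_transD:
  "\<lbrakk>f \<preceq> g; g \<preceq> h; f \<in> Hom C A B; g \<in> Hom C A B; h \<in> Hom C A B\<rbrakk> \<Longrightarrow> f \<preceq> h"
  using Le_trans by (blast dest: transp_onD)

lemma whisker_mono:
  assumes "x \<preceq> y" "x \<in> Hom C A B" "y \<in> Hom C A B" "f \<in> Hom C X A" "g \<in> Hom C B Y"
  shows "f \<cdot> (x \<cdot> g) \<preceq> f \<cdot> (y \<cdot> g)"
proof (rule Comp_mono)
  show "f \<in> Hom C X A" "f \<in> Hom C X A" by fact+
  show "x \<cdot> g \<in> Hom C A Y" "y \<cdot> g \<in> Hom C A Y"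
    using assms by (blast intro: Comp_Hom)+
  show "f \<preceq> f" using assms(4) by (rule Le_reflD)
  show "x \<cdot> g \<preceq> y \<cdot> g"
    using assms(2,3,5,5,1) Le_reflD[OF assms(5)] by (rule Comp_mono)
qed

text \<open>The unit of \<open>h\<close> is inserted inside the unit of \<open>g\<close>, and the
  counit of \<open>g\<close> is applied inside \<open>snd h \<cdot> fst h\<close> before the counit
  of \<open>h\<close>.\<close>

lemma is_adjunction_Comp:
  assumes g: "is_adjunction C A B g" and h: "is_adjunction C B D h"
  shows "is_adjunction C A D (fst g \<cdot> fst h, snd h \<cdot> snd g)"
proof -
  obtain g1 g2 h1 h2 where [simp]: "g = (g1, g2)" "h = (h1, h2)" by (cases g; cases h)
  from g h have hom: "g1 \<in> Hom C A B" "g2 \<in> Hom C B A" "h1 \<in> Hom C B D" "h2 \<in> Hom C D B"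
    and le: "Id C A \<preceq> g1 \<cdot> g2" "g2 \<cdot> g1 \<preceq> Id C B" "Id C B \<preceq> h1 \<cdot> h2" "h2 \<cdot> h1 \<preceq> Id C D"
    by (auto simp: is_adjunction_def)
  note obj = Hom_Obj[OF hom(1)] Hom_Obj[OF hom(3)]
  note H = HomD[OF hom(1)] HomD[OF hom(2)] HomD[OF hom(3)] HomD[OF hom(4)] obj
  have "g1 \<cdot> (Id C B \<cdot> g2) \<preceq> g1 \<cdot> ((h1 \<cdot> h2) \<cdot> g2)"
    by (rule whisker_mono[OF le(3)]) (auto intro: hom obj Id_Hom Comp_Hom)
  then have 1: "g1 \<cdot> g2 \<preceq> (g1 \<cdot> h1) \<cdot> (h2 \<cdot> g2)" using H by (simp add: arr_simps)
  have "h2 \<cdot> ((g2 \<cdot> g1) \<cdot> h1) \<preceq> h2 \<cdot> (Id C B \<cdot> h1)"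
    by (rule whisker_mono[OF le(2)]) (auto intro: hom obj Id_Hom Comp_Hom)
  then have 2: "(h2 \<cdot> g2) \<cdot> (g1 \<cdot> h1) \<preceq> h2 \<cdot> h1" using H by (simp add: arr_simps)
  have "Id C A \<preceq> (g1 \<cdot> h1) \<cdot> (h2 \<cdot> g2)"
    by (rule Le_transD[OF le(1) 1]) (auto intro: hom obj Id_Hom Comp_Hom)
  moreover have "(h2 \<cdot> g2) \<cdot> (g1 \<cdot> h1) \<preceq> Id C D"
    by (rule Le_transD[OF 2 le(4)]) (auto intro: hom obj Id_Hom Comp_Hom)
  ultimately show ?thesis
    by (auto simp: is_adjunction_def intro: hom Comp_Hom)
qed

lemma category_Adj_eq: "category (Adj_eq C)"
proof
  fix g assume "g \<in> Arr (Adj_eq C)"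
  then show "Dom (Adj_eq C) g \<in> Obj (Adj_eq C)" "Cod (Adj_eq C) g \<in> Obj (Adj_eq C)"
    by (auto simp: Adj_eq_def is_adjunction_def Hom_def)
next
  fix A assume "A \<in> Obj (Adj_eq C)"
  then have A: "posetal C A" "A \<in> Obj C" by (auto simp: Adj_eq_simps posetal_def)
  then show "Id (Adj_eq C) A \<in> Hom (Adj_eq C) A A"
    using Id_Hom[OF A(2)] Le_reflD[OF Id_Hom[OF A(2)]] Id_left[OF Id_Hom[OF A(2)]]
    by (simp add: Adj_eq_Hom_iff Adj_eq_simps is_adjunction_def)
next
  fix g h A B D assume "g \<in> Hom (Adj_eq C) A B" "h \<in> Hom (Adj_eq C) B D"
  then show "g \<cdot>\<^bsub>Adj_eq C\<^esub> h \<in> Hom (Adj_eq C) A D"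
    by (auto simp: Adj_eq_Hom_iff Adj_eq_simps intro: is_adjunction_Comp)
next
  fix g A B assume "g \<in> Hom (Adj_eq C) A B"
  then show "Id (Adj_eq C) A \<cdot>\<^bsub>Adj_eq C\<^esub> g = g" "g \<cdot>\<^bsub>Adj_eq C\<^esub> Id (Adj_eq C) B = g"
    by (auto simp: Adj_eq_Hom_iff Adj_eq_simps is_adjunction_def Id_left Id_right)
next
  fix f g h A B D E
  assume "f \<in> Hom (Adj_eq C) A B" "g \<in> Hom (Adj_eq C) B D" "h \<in> Hom (Adj_eq C) D E"
  then show "(f \<cdot>\<^bsub>Adj_eq C\<^esub> g) \<cdot>\<^bsub>Adj_eq C\<^esub> h = f \<cdot>\<^bsub>Adj_eq C\<^esub> (g \<cdot>\<^bsub>Adj_eq C\<^esub> h)"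
    by (auto simp: Adj_eq_Hom_iff Adj_eq_simps is_adjunction_def Comp_assoc)
qed

text \<open>In each equation the unit gives one inequality and the counit the other. Antisymmetry of
  arrows into \<open>B\<close> closes the first equation, antisymmetry of arrows into
  \<open>A\<close> the second.\<close>

lemma triangle_identities:
  assumes "posetal C A" "posetal C B" and g: "is_adjunction C A B (g1, g2)"
  shows "g1 \<cdot> (g2 \<cdot> g1) = g1" "g2 \<cdot> (g1 \<cdot> g2) = g2"
proof -
  from g have hom: "g1 \<in> Hom C A B" "g2 \<in> Hom C B A"
    and le: "Id C A \<preceq> g1 \<cdot> g2" "g2 \<cdot> g1 \<preceq> Id C B"
    by (auto simp: is_adjunction_def)
  note obj = Hom_Obj[OF hom(1)]
  note A = Id_Hom[OF obj(1)] and B = Id_Hom[OF obj(2)]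
  note g12 = Comp_Hom[OF hom] and g21 = Comp_Hom[OF hom(2,1)]
  note H = HomD[OF hom(1)] HomD[OF hom(2)] obj
  have "g1 \<cdot> (g2 \<cdot> g1) \<preceq> g1 \<cdot> Id C B"
    using hom(1,1) g21 B Le_reflD[OF hom(1)] le(2) by (rule Comp_mono)
  moreover have "Id C A \<cdot> g1 \<preceq> (g1 \<cdot> g2) \<cdot> g1"
    using A g12 hom(1,1) le(1) Le_reflD[OF hom(1)] by (rule Comp_mono)
  ultimately show "g1 \<cdot> (g2 \<cdot> g1) = g1"
    using H by (intro posetal_antisym[OF assms(2) obj(1) Comp_Hom[OF hom(1) g21] hom(1)])
      (simp_all add: arr_simps)
  have "g2 \<cdot> Id C A \<preceq> g2 \<cdot> (g1 \<cdot> g2)"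
    using hom(2,2) A g12 Le_reflD[OF hom(2)] le(1) by (rule Comp_mono)
  moreover have "(g2 \<cdot> g1) \<cdot> g2 \<preceq> Id C B \<cdot> g2"
    using g21 B hom(2,2) le(2) Le_reflD[OF hom(2)] by (rule Comp_mono)
  ultimately show "g2 \<cdot> (g1 \<cdot> g2) = g2"
    using H by (intro posetal_antisym[OF assms(1) obj(2) Comp_Hom[OF hom(2) g12] hom(2)])
      (simp_all add: arr_simps)
qed

text \<open>Since \<open>e1\<close> is split epi on left adjoints and split mono on right adjoints, \<open>c\<close> is forced.
  That this \<open>c\<close> fills the square uses that \<open>m2\<close> is split the other way round.\<close>

lemma Ref_Coref_diagonal:
  assumes e1: "e1 \<in> Ref C \<inter> Hom (Adj_eq C) A1 D1" and m1: "m1 \<in> Coref C \<inter> Hom (Adj_eq C) D1 B1"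
    and e2: "e2 \<in> Ref C \<inter> Hom (Adj_eq C) A2 D2" and m2: "m2 \<in> Coref C \<inter> Hom (Adj_eq C) D2 B2"
    and a: "a \<in> Hom (Adj_eq C) A1 A2" and b: "b \<in> Hom (Adj_eq C) B1 B2"
    and sq: "a \<cdot>\<^bsub>Adj_eq C\<^esub> (e2 \<cdot>\<^bsub>Adj_eq C\<^esub> m2) = (e1 \<cdot>\<^bsub>Adj_eq C\<^esub> m1) \<cdot>\<^bsub>Adj_eq C\<^esub> b"
  shows "\<exists>!c. c \<in> Hom (Adj_eq C) D1 D2 \<and> a \<cdot>\<^bsub>Adj_eq C\<^esub> e2 = e1 \<cdot>\<^bsub>Adj_eq C\<^esub> c \<and>
    c \<cdot>\<^bsub>Adj_eq C\<^esub> m2 = m1 \<cdot>\<^bsub>Adj_eq C\<^esub> b"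
proof -
  interpret K: category "Adj_eq C" by (rule category_Adj_eq)
  obtain r1 i1 n1 k1 r2 i2 n2 k2 l r u v
    where [simp]: "e1 = (r1, i1)" "m1 = (n1, k1)" "e2 = (r2, i2)" "m2 = (n2, k2)"
      "a = (l, r)" "b = (u, v)"
    by (cases e1; cases m1; cases e2; cases m2; cases a; cases b)
  from e1 m1 e2 m2 a b have hom:
    "r1 \<in> Hom C A1 D1" "i1 \<in> Hom C D1 A1" "n1 \<in> Hom C D1 B1" "k1 \<in> Hom C B1 D1"
    "r2 \<in> Hom C A2 D2" "i2 \<in> Hom C D2 A2" "n2 \<in> Hom C D2 B2" "k2 \<in> Hom C B2 D2"
    "l \<in> Hom C A1 A2" "r \<in> Hom C A2 A1" "u \<in> Hom C B1 B2" "v \<in> Hom C B2 B1"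
    and unit: "Id C A2 \<preceq> r2 \<cdot> i2" "Id C A1 \<preceq> l \<cdot> r" and counit: "r \<cdot> l \<preceq> Id C A2"
    and split: "i1 \<cdot> r1 = Id C D1" "i2 \<cdot> r2 = Id C D2" "n1 \<cdot> k1 = Id C D1" "n2 \<cdot> k2 = Id C D2"
    and pos: "posetal C D1" "posetal C D2"
    unfolding Ref_Hom_iff Coref_Hom_iff Adj_eq_Hom_iff by (auto simp: is_adjunction_def)
  note obj = Hom_Obj[OF hom(1)] Hom_Obj[OF hom(3)] Hom_Obj[OF hom(5)] Hom_Obj[OF hom(7)]
  note H = hom[THEN HomD(1)] hom[THEN HomD(2)] hom[THEN HomD(3)] obj
  note I = hom obj[THEN Id_Hom] Comp_Hom
  have split': "i1 \<cdot> (r1 \<cdot> x) = x" if "x \<in> Hom C D1 X" for x X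
    using Comp_assoc[OF hom(2,1) that] Id_left[OF that] by (simp add: split)
  from sq H have sq1: "l \<cdot> (r2 \<cdot> n2) = r1 \<cdot> (n1 \<cdot> u)" and sq2: "k2 \<cdot> (i2 \<cdot> r) = v \<cdot> (k1 \<cdot> i1)"
    by (simp_all add: Adj_eq_simps arr_simps)
  \<comment> \<open>Precomposing \<open>l \<cdot> r2 = r1 \<cdot> p\<close> with \<open>i1\<close>,
    and postcomposing \<open>i2 \<cdot> r = q \<cdot> i1\<close> with \<open>r1\<close>, leaves only
    these candidates, since \<open>i1 \<cdot> r1\<close> is an identity.\<close>
  define p where "p = i1 \<cdot> (l \<cdot> r2)"
  define q where "q = i2 \<cdot> (r \<cdot> r1)"
  have pq: "p \<in> Hom C D1 D2" "q \<in> Hom C D2 D1"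
    unfolding p_def q_def by (rule I | rule hom)+
  \<comment> \<open>Cancelling \<open>n2\<close> by means of \<open>k2\<close> in the outer square
    shows that \<open>l \<cdot> r2\<close> begins with \<open>r1\<close>, so that it absorbs
    \<open>r1 \<cdot> i1\<close> on its left. Dually, \<open>i2 \<cdot> r\<close> will be seen to
    end with \<open>i1\<close>.\<close>
  have lr2: "l \<cdot> r2 = r1 \<cdot> (n1 \<cdot> (u \<cdot> k2))"
  proof -
    have "l \<cdot> r2 = (l \<cdot> (r2 \<cdot> n2)) \<cdot> k2" using H by (simp add: arr_simps split)
    also have "\<dots> = r1 \<cdot> (n1 \<cdot> (u \<cdot> k2))" unfolding sq1 using H by (simp add: arr_simps)
    finally show ?thesis .
  qed
  have i2r: "i2 \<cdot> r = n2 \<cdot> (v \<cdot> (k1 \<cdot> i1))"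
  proof -
    have "i2 \<cdot> r = (n2 \<cdot> k2) \<cdot> (i2 \<cdot> r)" unfolding split using H by (simp add: arr_simps)
    also have "\<dots> = n2 \<cdot> (k2 \<cdot> (i2 \<cdot> r))" using H by (simp add: arr_simps)
    finally show ?thesis unfolding sq2 .
  qed
  have fill1: "r1 \<cdot> p = l \<cdot> r2"
    unfolding p_def lr2 by (subst split'[of _ D2]) (auto intro: I)
  have fill2: "q \<cdot> i1 = i2 \<cdot> r"
  proof -
    have "q \<cdot> i1 = (i2 \<cdot> r) \<cdot> (r1 \<cdot> i1)" unfolding q_def using H by (simp add: arr_simps)
    also have "\<dots> = n2 \<cdot> (v \<cdot> (k1 \<cdot> (i1 \<cdot> (r1 \<cdot> i1))))"
      unfolding i2r using H by (simp add: arr_simps)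
    also have "i1 \<cdot> (r1 \<cdot> i1) = i1" by (rule split') (rule hom)
    finally show ?thesis unfolding i2r .
  qed
  have adj: "is_adjunction C D1 D2 (p, q)"
  proof -
    \<comment> \<open>The unit of \<open>(p, q)\<close> comes from
      \<open>i1 \<cdot> r1 = Id C D1\<close> by inserting the unit of \<open>a\<close> and then that
      of \<open>e2\<close>.\<close>
    have "i1 \<cdot> (Id C A1 \<cdot> r1) \<preceq> i1 \<cdot> ((l \<cdot> r) \<cdot> r1)"
      by (rule whisker_mono[OF unit(2)]) (rule I hom)+
    then have 1: "Id C D1 \<preceq> i1 \<cdot> (l \<cdot> (r \<cdot> r1))" using H by (simp add: arr_simps split)
    have "(i1 \<cdot> l) \<cdot> (Id C A2 \<cdot> (r \<cdot> r1)) \<preceq> (i1 \<cdot> l) \<cdot> ((r2 \<cdot> i2) \<cdot> (r \<cdot> r1))"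
      by (rule whisker_mono[OF unit(1)]) (rule I hom)+
    then have 2: "i1 \<cdot> (l \<cdot> (r \<cdot> r1)) \<preceq> p \<cdot> q"
      unfolding p_def q_def using H by (simp add: arr_simps)
    have 3: "Id C D1 \<preceq> p \<cdot> q"
      by (rule Le_transD[OF 1 2]) (rule I pq hom)+
    \<comment> \<open>For the counit, \<open>r1 \<cdot> i1\<close> in the middle of
      \<open>q \<cdot> p\<close> has to disappear. The unit of \<open>e1\<close> bounds it from
      below only, which is the wrong direction; \<open>fill2\<close> removes it by an
      equality.\<close>
    have "q \<cdot> p = (q \<cdot> i1) \<cdot> (l \<cdot> r2)"
      unfolding p_def using H HomD[OF pq(2)] by (simp add: arr_simps)
    also have "\<dots> = i2 \<cdot> ((r \<cdot> l) \<cdot> r2)" unfolding fill2 using H by (simp add: arr_simps)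
    finally have 4: "q \<cdot> p = i2 \<cdot> ((r \<cdot> l) \<cdot> r2)" .
    have "i2 \<cdot> ((r \<cdot> l) \<cdot> r2) \<preceq> i2 \<cdot> (Id C A2 \<cdot> r2)"
      by (rule whisker_mono[OF counit]) (rule I hom)+
    then have "q \<cdot> p \<preceq> Id C D2" using H by (simp add: 4 arr_simps split)
    with 3 pq show ?thesis by (simp add: is_adjunction_def)
  qed
  have c: "(p, q) \<in> Hom (Adj_eq C) D1 D2" using adj pos by (simp add: Adj_eq_Hom_iff)
  have c_e: "a \<cdot>\<^bsub>Adj_eq C\<^esub> e2 = e1 \<cdot>\<^bsub>Adj_eq C\<^esub> (p, q)"
    by (simp add: Adj_eq_simps fill1 fill2)
  \<comment> \<open>\<open>e1\<close> is left cancellable among adjunctions. This gives uniqueness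
    of the diagonal, and also its second square, by cancelling \<open>e1\<close> from the outer
    one.\<close>
  have epi: "x = y" if "x \<in> Hom (Adj_eq C) D1 X" "y \<in> Hom (Adj_eq C) D1 X"
    "e1 \<cdot>\<^bsub>Adj_eq C\<^esub> x = e1 \<cdot>\<^bsub>Adj_eq C\<^esub> y" for x y X
  proof (rule prod_eqI)
    have xy: "fst x \<in> Hom C D1 X" "fst y \<in> Hom C D1 X"
      "snd x \<in> Hom C X D1" "snd y \<in> Hom C X D1"
      using that(1,2) by (simp_all add: Adj_eq_Hom_iff is_adjunction_def)
    have eq: "r1 \<cdot> fst x = r1 \<cdot> fst y" "snd x \<cdot> i1 = snd y \<cdot> i1"
      using that(3) by (simp_all add: Adj_eq_simps)
    show "fst x = fst y"
      using split'[OF xy(1)] unfolding eq(1) split'[OF xy(2)] by (rule sym)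
    have "snd x = (snd x \<cdot> i1) \<cdot> r1"
      using Comp_assoc[OF xy(3) hom(2,1)] Id_right[OF xy(3)] by (simp add: split)
    also have "\<dots> = snd y"
      unfolding eq(2) using Comp_assoc[OF xy(4) hom(2,1)] Id_right[OF xy(4)] by (simp add: split)
    finally show "snd x = snd y" .
  qed
  note eK = IntD2[OF e1] and mK = IntD2[OF m1] and eK2 = IntD2[OF e2] and mK2 = IntD2[OF m2]
  have "(p, q) \<cdot>\<^bsub>Adj_eq C\<^esub> m2 = m1 \<cdot>\<^bsub>Adj_eq C\<^esub> b"
  proof (rule epi[OF K.Comp_Hom[OF c mK2] K.Comp_Hom[OF mK b]])
    show "e1 \<cdot>\<^bsub>Adj_eq C\<^esub> ((p, q) \<cdot>\<^bsub>Adj_eq C\<^esub> m2) = e1 \<cdot>\<^bsub>Adj_eq C\<^esub> (m1 \<cdot>\<^bsub>Adj_eq C\<^esub> b)"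
      unfolding K.Comp_assoc[OF eK c mK2, symmetric] K.Comp_assoc[OF eK mK b, symmetric]
        c_e[symmetric] K.Comp_assoc[OF a eK2 mK2] by (rule sq)
  qed
  moreover have "x = (p, q)"
    if "x \<in> Hom (Adj_eq C) D1 D2" "a \<cdot>\<^bsub>Adj_eq C\<^esub> e2 = e1 \<cdot>\<^bsub>Adj_eq C\<^esub> x" for x
    using epi[OF that(1) c] that(2) c_e by simp
  ultimately show ?thesis using c c_e by blast
qed

end

section \<open>Splitting idempotents, and existence of factorizations\<close>

context cs_category
begin

text \<open>A splitting of \<open>t\<close> is a limit of \<open>t\<close> regarded as a diagram on the two-element monoid
  \<open>{0, 1}\<close> with \<open>max\<close> as multiplication.\<close>

lemma idempotent_splits:
  assumes t: "t \<in> Hom C A A" and idem: "t \<cdot> t = t"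
  shows "\<exists>D. \<exists>r \<in> Hom C A D. \<exists>i \<in> Hom C D A. r \<cdot> i = t \<and> i \<cdot> r = Id C D"
proof -
  note A = Hom_Obj(1)[OF t]
  define J :: "(nat, nat) cat" where
    "J = \<lparr>Obj = {0}, Arr = {0, 1}, Dom = (\<lambda>_. 0), Cod = (\<lambda>_. 0), Id = (\<lambda>_. 0), Comp = max\<rparr>"
  define F where "F = \<lparr>FObj = (\<lambda>_ :: nat. A), FArr = (\<lambda>u :: nat. if u = 0 then Id C A else t)\<rparr>"
  have "is_functor J C F"
    by unfold_locales
      (auto simp: J_def F_def Hom_def[of "\<lparr>Obj = _, Arr = _, Dom = _, Cod = _, Id = _, Comp = _\<rparr>"]
        A t idem Id_Hom Id_left[OF t] Id_right[OF t] Id_left[OF Id_Hom[OF A]])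
  moreover have "finite (Obj J)" "finite (Arr J)" by (simp_all add: J_def)
  ultimately obtain D p where lim: "is_limit J C F D p"
    using finite_limits unfolding has_finite_limits_def by blast
  \<comment> \<open>A cone amounts to an arrow fixed by \<open>t\<close>, so the limit is the
    equalizer of \<open>t\<close> and the identity.\<close>
  have cone_iff: "is_cone J C F X q \<longleftrightarrow> q 0 \<in> Hom C X A \<and> q 0 \<cdot> t = q 0" for X q
    using Hom_Obj(1)[of "q 0" X A] Id_right[of "q 0" X A]
    by (auto simp: is_cone_def J_def F_def)
  define i where "i = p 0"
  have i: "i \<in> Hom C D A" "i \<cdot> t = i"
    using lim by (auto simp: is_limit_def cone_iff i_def)
  have univ: "\<exists>!h. h \<in> Hom C X D \<and> h \<cdot> i = x" if "x \<in> Hom C X A" "x \<cdot> t = x" for X x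
  proof -
    have "is_cone J C F X (\<lambda>_. x)" using that by (simp add: cone_iff)
    with lim have "\<exists>!h. h \<in> Hom C X D \<and> (\<forall>j \<in> Obj J. h \<cdot> p j = x)"
      unfolding is_limit_def by blast
    then show ?thesis by (simp add: J_def i_def)
  qed
  \<comment> \<open>Idempotence says that \<open>t\<close> is itself fixed by \<open>t\<close>, so
    it factors through \<open>i\<close>.\<close>
  obtain r where r: "r \<in> Hom C A D" "r \<cdot> i = t" using univ[OF t idem] by blast
  have "(i \<cdot> r) \<cdot> i = i" using Comp_assoc[OF i(1) r(1) i(1)] by (simp add: r(2) i(2))
  \<comment> \<open>Both sides factor \<open>i\<close> through \<open>i\<close>, and such a
    factorization is unique.\<close>
  then have "i \<cdot> r = Id C D"
    using univ[OF i] Comp_Hom[OF i(1) r(1)] Id_Hom[OF Hom_Obj(1)[OF i(1)]] Id_left[OF i(1)] by blast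
  with r i(1) show ?thesis by blast
qed

text \<open>Composing with \<open>i\<close> is monotone and carries comparisons into
  \<open>A\<close>, where antisymmetry holds; composing with \<open>r\<close> then recovers the
  original arrows.\<close>

lemma posetal_retract:
  assumes "posetal C A" "i \<in> Hom C D A" "r \<in> Hom C A D" "i \<cdot> r = Id C D"
  shows "posetal C D"
  unfolding posetal_def
proof (intro conjI ballI antisymp_onI)
  show "D \<in> Obj C" using Hom_Obj(1)[OF assms(2)] .
  fix X x y assume X: "X \<in> Obj C" and xy: "x \<in> Hom C X D" "y \<in> Hom C X D" "x \<preceq> y" "y \<preceq> x"
  have "x \<cdot> i = y \<cdot> i"
  proof (rule posetal_antisym[OF assms(1) X])
    show "x \<cdot> i \<in> Hom C X A" "y \<cdot> i \<in> Hom C X A"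
      using xy assms(2) by (blast intro: Comp_Hom)+
    show "x \<cdot> i \<preceq> y \<cdot> i" "y \<cdot> i \<preceq> x \<cdot> i"
      using Comp_mono[OF xy(1,2) assms(2,2) xy(3)] Comp_mono[OF xy(2,1) assms(2,2) xy(4)]
        Le_reflD[OF assms(2)] by blast+
  qed
  then have "x \<cdot> (i \<cdot> r) = y \<cdot> (i \<cdot> r)"
    by (simp add: Comp_assoc[OF xy(1) assms(2,3), symmetric]
        Comp_assoc[OF xy(2) assms(2,3), symmetric])
  then show "x = y" using xy by (simp add: assms(4) Id_right)
qed

text \<open>With \<open>r \<cdot> i = g1 \<cdot> g2\<close> split through \<open>D\<close>, the
  reflection is \<open>(r, i)\<close> and the coreflection is \<open>g\<close> restricted to
  \<open>D\<close>, namely \<open>(i \<cdot> g1, g2 \<cdot> r)\<close>.\<close>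

lemma Ref_Coref_factorization:
  assumes g: "g \<in> Hom (Adj_eq C) A B"
  shows "\<exists>D. \<exists>e \<in> Ref C \<inter> Hom (Adj_eq C) A D. \<exists>m \<in> Coref C \<inter> Hom (Adj_eq C) D B.
    e \<cdot>\<^bsub>Adj_eq C\<^esub> m = g"
proof -
  obtain g1 g2 where [simp]: "g = (g1, g2)" by (cases g)
  from g have pos: "posetal C A" "posetal C B" and adj: "is_adjunction C A B (g1, g2)"
    by (auto simp: Adj_eq_Hom_iff)
  from adj have hom: "g1 \<in> Hom C A B" "g2 \<in> Hom C B A"
    and le: "Id C A \<preceq> g1 \<cdot> g2" "g2 \<cdot> g1 \<preceq> Id C B"
    by (auto simp: is_adjunction_def)
  note tri = triangle_identities[OF pos adj]
  have "(g1 \<cdot> g2) \<cdot> (g1 \<cdot> g2) = g1 \<cdot> g2"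
    using Comp_assoc[OF hom Comp_Hom[OF hom]] tri(2) by simp
  from idempotent_splits[OF Comp_Hom[OF hom] this]
  obtain D r i where r: "r \<in> Hom C A D" and i: "i \<in> Hom C D A"
    and ri: "r \<cdot> i = g1 \<cdot> g2" and ir: "i \<cdot> r = Id C D" by blast
  have D: "posetal C D" by (rule posetal_retract[OF pos(1) i r ir])
  note H = hom[THEN HomD(1)] hom[THEN HomD(2)] hom[THEN HomD(3)] HomD[OF r] HomD[OF i]
    Hom_Obj[OF hom(1)] Hom_Obj[OF r]
  note I = hom r i Comp_Hom
  \<comment> \<open>Since \<open>r \<cdot> i = g1 \<cdot> g2\<close>, the unit of \<open>g\<close>
    serves as the unit of \<open>(r, i)\<close>.\<close>
  have ref: "is_adjunction C A D (r, i)"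
    using r i le ri ir Le_reflD[OF Id_Hom[OF Hom_Obj(2)[OF r]]] by (simp add: is_adjunction_def)
  have "(i \<cdot> g1) \<cdot> (g2 \<cdot> r) = i \<cdot> ((g1 \<cdot> g2) \<cdot> r)" using H by (simp add: arr_simps)
  also have "\<dots> = (i \<cdot> r) \<cdot> (i \<cdot> r)" unfolding ri[symmetric] using H by (simp add: arr_simps)
  also have "\<dots> = Id C D" unfolding ir using H by (simp add: arr_simps)
  finally have split: "(i \<cdot> g1) \<cdot> (g2 \<cdot> r) = Id C D" .
  \<comment> \<open>By the first triangle identity the second factor has the same
    \<open>g2 \<cdot> g1\<close> as \<open>g\<close>, hence inherits its counit.\<close>
  have "(g2 \<cdot> r) \<cdot> (i \<cdot> g1) = g2 \<cdot> ((r \<cdot> i) \<cdot> g1)" using H by (simp add: arr_simps)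
  also have "\<dots> = g2 \<cdot> (g1 \<cdot> (g2 \<cdot> g1))" unfolding ri using H by (simp add: arr_simps)
  finally have "(g2 \<cdot> r) \<cdot> (i \<cdot> g1) = g2 \<cdot> g1" unfolding tri .
  then have coref: "is_adjunction C D B (i \<cdot> g1, g2 \<cdot> r)"
    using split le Le_reflD[OF Id_Hom[OF Hom_Obj(2)[OF r]]]
    by (auto simp: is_adjunction_def intro: I)
  \<comment> \<open>Recomposing yields \<open>g1 \<cdot> g2 \<cdot> g1\<close> and
    \<open>g2 \<cdot> g1 \<cdot> g2\<close>, which the triangle identities collapse to
    \<open>g1\<close> and \<open>g2\<close>.\<close>
  have "r \<cdot> (i \<cdot> g1) = (r \<cdot> i) \<cdot> g1" "(g2 \<cdot> r) \<cdot> i = g2 \<cdot> (r \<cdot> i)"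
    using H by (simp_all add: arr_simps)
  then have "(r, i) \<cdot>\<^bsub>Adj_eq C\<^esub> (i \<cdot> g1, g2 \<cdot> r) = g"
    unfolding ri using H tri by (simp add: Adj_eq_simps arr_simps)
  moreover have "(r, i) \<in> Ref C \<inter> Hom (Adj_eq C) A D"
    unfolding Ref_Hom_iff using pos D ref ir by simp
  moreover have "(i \<cdot> g1, g2 \<cdot> r) \<in> Coref C \<inter> Hom (Adj_eq C) D B"
    unfolding Coref_Hom_iff using pos D coref split by simp
  ultimately show ?thesis by blast
qed

end

theorem mainTheorem4:
  fixes C :: "('o, 'm) ord_cat"
  assumes "cs_category C"
  shows "equivalent_categories
    (arrow_cat (Adj_eq C))
    (fact_cat (Adj_eq C) (Ref C) (Coref C))"
proof -
  interpret cs_category C by fact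
  interpret K: category "Adj_eq C" by (rule category_Adj_eq)
  show ?thesis
    by (rule K.arrow_cat_equivalent_fact_cat[OF Ref_Coref_factorization Ref_Coref_diagonal])
qed

end
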